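(* Non-uniformly Anosov cocycles are $C^0$-dense in the set of partially hyperbolic cocycles with non-trivial unstable bundle: for every partially hyperbolic cocycle $A\in C^0_I(X,\mathcal{C}(\mathcal{H}))$ with non-trivial unstable bundle and every $\epsilon>0$, there exists a non-uniformly Anosov cocycle $C\in C^0_I(X,\mathcal{C}(\mathcal{H}))$ which is $\epsilon$-$C^0$-close to $A$.
   Context: Setting. $\mathcal{H}$ is an infinite dimensional separable Hilbert space, $\mathcal{C}(\mathcal{H})$ is the set of compact linear operators on $\mathcal{H}$ with the uniform (operator) norm, $X$ is a compact Hausdorff space, $f:X\to X$ is a homeomorphism, and $\mu$ is an $f$-invariant ergodic Borel probability measure which is positive on non-empty open subsets of $X$. $C^0_I(X,\mathcal{C}(\mathcal{H}))$ is the set of continuous maps (cocycles) $A:X\to\mathcal{C}(\mathcal{H})$ with $\int_X\log^+\|A(x)\|\,d\mu(x)<\infty$, where $\log^+(y)=\max\{0,\log y\}$, with the $C^0$ norm $\|A\|=\sup_{x\in X}\|A(x)\|$; $\epsilon$-$C^0$-close means at $C^0$-distance at most $\epsilon$. Write $A^0(x)=id$ and $A^n(x)=A(f^{n-1}(x))\circ\cdots\circ A(f(x))\circ A(x)$. Lyapunov exponents. By Ruelle's theorem, for $\mu$-a.e. $x$ the limit $\mathcal{L}(x)=\lim_n (A^n(x)^*A^n(x))^{1/(2n)}$ exists and is a compact operator. If $e^{\lambda_1}>e^{\lambda_2}>\cdots$ are its distinct nonzero eigenvalues, with associated eigenspaces $U_1(x),U_2(x),\dots$ of dimensions $n_1,n_2,\dots$,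 the numbers $\lambda_i$ are the Lyapunov exponents of $A$, with multiplicities $n_i$; they and the $n_i$ are $\mu$-a.e. constant by ergodicity. The kernel of $\mathcal{L}(x)$ corresponds to the exponent $-\infty$. The spaces $U_i(x)$ and $\ker\mathcal{L}(x)$ are the Oseledets subspaces and form the Oseledets-Ruelle decomposition. $\mathcal{O}(A)$ denotes the full-measure (hence dense) set of points where this holds. Domination. Given $\ell\in\mathbb{N}$ and $\alpha\in\,]0,1[$, a direct sum $E_1(x)\oplus E_2(x)$ on an $f$-invariant set $K$ is $\ell,\alpha$-dominated, written $E_1\succ_{\ell,\alpha}E_2$, if (I) $A(x)(E_i(x))\subset E_i(f(x))$ for all $x\in K$; (II) $\dim E_i(x)$ is constant in $x$ for $i=1,2$; (III) there is $\theta>0$ such that for every $x\in K$ and all unit vectors $u\in E_2(x)$, $v\in E_1(x)$: $\|A(x)v\|\ge\theta$ and $\|A^\ell(x)u\|\le\alpha\|A^\ell(x)v\|$. The Oseledets-Ruelle decomposition on $\mathcal{O}(A)$ is $\ell,\alpha$-dominated if its subspaces can be grouped so that it is rewritten as $E_1(x)\oplus\cdots\oplus E_k(x)=\mathcal{H}$ with constant dimensions and $E_i\succ_{\ell,\alpha}E_j$ for all $i<j$; a dominated decomposition extends continuously to a dominated splitting over the closure of $\mathcal{O}(A)$, which is $X$ (the extended Oseledets-Ruelle decomposition). Partial hyperbolicity. A cocycle $A\in C^0_I(X,\mathcal{C}(\mathcal{H}))$ with an extended Oseledets-Ruelle decomposition is partially hyperbolic if for every $x\in X$ this splitting may be rewritten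 as $E^u_x\oplus E^c_x\oplus E^s_x=\mathcal{H}$ and there are $\ell\in\mathbb{N}$, $\alpha,\beta\in\,]0,1[$ such that: (1) $E^u_x$ contains only Oseledets subspaces associated to positive Lyapunov exponents; (2) $E^c_x$ contains the sum of all Oseledets subspaces associated to zero Lyapunov exponents; (3) $E^s_x$ contains only Oseledets subspaces associated to negative Lyapunov exponents and includes all those with exponent $-\infty$; (4) $E^u\succ_{\ell,\alpha}E^c$ and $E^c\succ_{\ell,\beta}E^s$. The unstable bundle is non-trivial if $E^u_x\ne\{\vec 0\}$ for every $x\in X$. A cocycle is non-uniformly Anosov if it is partially hyperbolic and none of its Lyapunov exponents is zero. *)

theory Defs
  imports "HOL-Probability.Probability"
begin

section \<open>Scalars, dimension, operators\<close>

text \<open>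
  A real Hilbert space is a type of sort \<open>{real_inner, banach}\<close>. A complex Hilbert space
  is such a space (with the real part of its inner product) together with the operator \<open>J\<close>
  of multiplication by the imaginary unit, which is an isometry with square \<open>-1\<close>. The set
  \<open>S\<close> below is empty in the real case and \<open>{J}\<close> in the complex case; an operator is linear
  over the scalar field iff it is real-linear and commutes with the elements of \<open>S\<close>.
  For such operators, compactness, norm, adjoint, positive roots and eigenspaces for real
  eigenvalues do not depend on which of the two structures is used. Complex dimension is half
  the real one, so that constancy of a dimension does not depend on it either.
\<close>

definition scalar_structure :: "('h::{real_inner,banach} \<Rightarrow>\<^sub>L 'h) set \<Rightarrow> bool" where
  "scalar_structure S \<longleftrightarrow>
     S = {} \<or>
     (\<exists>J. S = {J} \<and> J o\<^sub>L J = - id_blinfun \<and> (\<forall>u v. inner (J u) (J v) = inner u v))"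

definition scalar_linear ::
  "('h::{real_inner,banach} \<Rightarrow>\<^sub>L 'h) set \<Rightarrow> ('h \<Rightarrow>\<^sub>L 'h) \<Rightarrow> bool" where
  "scalar_linear S T \<longleftrightarrow> (\<forall>J\<in>S. T o\<^sub>L J = J o\<^sub>L T)"

definition finite_dimensional :: "'h::real_vector set \<Rightarrow> bool" where
  "finite_dimensional V \<longleftrightarrow> (\<exists>B. finite B \<and> V \<subseteq> span B)"

text \<open>The library's \<^const>\<open>dim\<close> is \<open>0\<close> on infinite dimensional spaces.\<close>

definition edim :: "'h::real_vector set \<Rightarrow> enat" where
  "edim V = (if finite_dimensional V then enat (dim V) else \<infinity>)"

definition compact_operator :: "('h::real_normed_vector \<Rightarrow>\<^sub>L 'h) \<Rightarrow> bool" where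
  "compact_operator T \<longleftrightarrow> (\<forall>B. bounded B \<longrightarrow> compact (closure (T ` B)))"

definition positive_operator :: "('h::real_inner \<Rightarrow>\<^sub>L 'h) \<Rightarrow> bool" where
  "positive_operator T \<longleftrightarrow>
     (\<forall>u v. inner (T u) v = inner u (T v)) \<and> (\<forall>v. 0 \<le> inner (T v) v)"

section \<open>Base dynamics and cocycles\<close>

definition invariant_measure :: "'x measure \<Rightarrow> ('x \<Rightarrow> 'x) \<Rightarrow> bool" where
  "invariant_measure M f \<longleftrightarrow> f \<in> measurable M M \<and> distr M M f = M"

definition ergodic_measure :: "'x measure \<Rightarrow> ('x \<Rightarrow> 'x) \<Rightarrow> bool" where
  "ergodic_measure M f \<longleftrightarrow>
     (\<forall>B\<in>sets M. f -` B \<inter> space M = B \<longrightarrow> measure M B = 0 \<or> measure M B = 1)"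

text \<open>As \<open>ln 0 = 0\<close>, the integrand below is \<open>log\<^sup>+\<close> also where \<open>A x = 0\<close>.\<close>

definition integrable_cocycle ::
  "('h::{real_inner,banach} \<Rightarrow>\<^sub>L 'h) set \<Rightarrow> 'x::topological_space measure \<Rightarrow>
     ('x \<Rightarrow> 'h \<Rightarrow>\<^sub>L 'h) \<Rightarrow> bool" where
  "integrable_cocycle S M A \<longleftrightarrow>
     continuous_on UNIV A \<and>
     (\<forall>x. compact_operator (A x) \<and> scalar_linear S (A x)) \<and>
     integrable M (\<lambda>x. max 0 (ln (norm (A x))))"

primrec cocycle_iterate ::
  "('x \<Rightarrow> 'x) \<Rightarrow> ('x \<Rightarrow> 'h::real_normed_vector \<Rightarrow>\<^sub>L 'h) \<Rightarrow> nat \<Rightarrow> 'x \<Rightarrow> 'h \<Rightarrow>\<^sub>L 'h" where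
  "cocycle_iterate f A 0 x = id_blinfun"
| "cocycle_iterate f A (Suc n) x = A ((f ^^ n) x) o\<^sub>L cocycle_iterate f A n x"

section \<open>Lyapunov exponents and Oseledets subspaces\<close>

text \<open>\<open>R n\<close> is the positive \<open>2n\<close>-th root of the operator \<open>A\<^sup>n(x)\<^sup>* A\<^sup>n(x)\<close>.\<close>

definition lyapunov_limit ::
  "('x \<Rightarrow> 'x) \<Rightarrow> ('x \<Rightarrow> 'h::{real_inner,banach} \<Rightarrow>\<^sub>L 'h) \<Rightarrow> 'x \<Rightarrow> ('h \<Rightarrow>\<^sub>L 'h) \<Rightarrow> bool" where
  "lyapunov_limit f A x L \<longleftrightarrow>
     (\<exists>R. (\<forall>n\<ge>1. positive_operator (R n) \<and>
             (blinfun_apply (R n)) ^^ (2 * n) =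
               adjoint (blinfun_apply (cocycle_iterate f A n x)) \<circ>
               blinfun_apply (cocycle_iterate f A n x)) \<and>
          R \<longlonglongrightarrow> L)"

definition lyapunov_operator ::
  "('x \<Rightarrow> 'x) \<Rightarrow> ('x \<Rightarrow> 'h::{real_inner,banach} \<Rightarrow>\<^sub>L 'h) \<Rightarrow> 'x \<Rightarrow> 'h \<Rightarrow>\<^sub>L 'h" where
  "lyapunov_operator f A x = (THE L. lyapunov_limit f A x L)"

text \<open>Positive roots are unique, so the uniqueness demanded here is no restriction.\<close>

definition has_lyapunov_operator ::
  "('x \<Rightarrow> 'x) \<Rightarrow> ('x \<Rightarrow> 'h::{real_inner,banach} \<Rightarrow>\<^sub>L 'h) \<Rightarrow> 'x \<Rightarrow> bool" where
  "has_lyapunov_operator f A x \<longleftrightarrow>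
     (\<exists>!L. lyapunov_limit f A x L) \<and> compact_operator (lyapunov_operator f A x)"

text \<open>The exponent \<open>-\<infinity>\<close> labels the kernel; the label \<open>\<infinity>\<close> is excluded wherever this is used.\<close>

definition oseledets_space ::
  "('x \<Rightarrow> 'x) \<Rightarrow> ('x \<Rightarrow> 'h::{real_inner,banach} \<Rightarrow>\<^sub>L 'h) \<Rightarrow> 'x \<Rightarrow> ereal \<Rightarrow> 'h set" where
  "oseledets_space f A x l =
     {v. lyapunov_operator f A x v =
           (if l = -\<infinity> then 0 else exp (real_of_ereal l)) *\<^sub>R v}"

definition lyapunov_exponents ::
  "'x measure \<Rightarrow> ('x \<Rightarrow> 'x) \<Rightarrow> ('x \<Rightarrow> 'h::{real_inner,banach} \<Rightarrow>\<^sub>L 'h) \<Rightarrow> ereal set" where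
  "lyapunov_exponents M f A =
     {l. l < \<infinity> \<and> (AE x in M. has_lyapunov_operator f A x \<and> oseledets_space f A x l \<noteq> {0})}"

text \<open>A point is regular if the limit exists there and every exponent occurs with its
  almost everywhere constant multiplicity. \<open>oseledets_set\<close> consists of the points whose full
  orbit is regular; this makes it \<open>f\<close>-invariant and changes it by a null set only.\<close>

definition regular_point ::
  "'x measure \<Rightarrow> ('x \<Rightarrow> 'x) \<Rightarrow> ('x \<Rightarrow> 'h::{real_inner,banach} \<Rightarrow>\<^sub>L 'h) \<Rightarrow> 'x \<Rightarrow> bool" where
  "regular_point M f A x \<longleftrightarrow>
     has_lyapunov_operator f A x \<and>
     (\<forall>l<\<infinity>. AE y in M. has_lyapunov_operator f A y \<and>
               edim (oseledets_space f A y l) = edim (oseledets_space f A x l))"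

definition oseledets_set ::
  "'x measure \<Rightarrow> ('x \<Rightarrow> 'x) \<Rightarrow> ('x \<Rightarrow> 'h::{real_inner,banach} \<Rightarrow>\<^sub>L 'h) \<Rightarrow> 'x set" where
  "oseledets_set M f A =
     {x. \<forall>n. regular_point M f A ((f ^^ n) x) \<and> regular_point M f A ((inv f ^^ n) x)}"

section \<open>Domination\<close>

definition dominated ::
  "('x \<Rightarrow> 'x) \<Rightarrow> ('x \<Rightarrow> 'h::{real_inner,banach} \<Rightarrow>\<^sub>L 'h) \<Rightarrow> 'x set \<Rightarrow> nat \<Rightarrow> real \<Rightarrow>
     ('x \<Rightarrow> 'h set) \<Rightarrow> ('x \<Rightarrow> 'h set) \<Rightarrow> bool" where
  "dominated f A K l \<alpha> E1 E2 \<longleftrightarrow>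
     f ` K = K \<and>
     (\<forall>x\<in>K. subspace (E1 x) \<and> subspace (E2 x) \<and> E1 x \<inter> E2 x = {0}) \<and>
     (\<forall>x\<in>K. A x ` E1 x \<subseteq> E1 (f x) \<and> A x ` E2 x \<subseteq> E2 (f x)) \<and>
     (\<forall>x\<in>K. \<forall>y\<in>K. edim (E1 x) = edim (E1 y) \<and> edim (E2 x) = edim (E2 y)) \<and>
     (\<exists>\<theta>>0. \<forall>x\<in>K. \<forall>u\<in>E2 x. \<forall>v\<in>E1 x. norm u = 1 \<longrightarrow> norm v = 1 \<longrightarrow>
        \<theta> \<le> norm (A x v) \<and>
        norm (cocycle_iterate f A l x u) \<le> \<alpha> * norm (cocycle_iterate f A l x v))"

definition direct_sum_decomposition :: "nat \<Rightarrow> (nat \<Rightarrow> 'h::real_vector set) \<Rightarrow> bool" where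
  "direct_sum_decomposition k E \<longleftrightarrow>
     (\<forall>i<k. subspace (E i)) \<and>
     bij_betw (\<lambda>w. \<Sum>i<k. w i) (PiE {..<k} E) UNIV"

definition dominated_splitting ::
  "('x \<Rightarrow> 'x) \<Rightarrow> ('x \<Rightarrow> 'h::{real_inner,banach} \<Rightarrow>\<^sub>L 'h) \<Rightarrow> 'x set \<Rightarrow> nat \<Rightarrow> real \<Rightarrow>
     nat \<Rightarrow> (nat \<Rightarrow> 'x \<Rightarrow> 'h set) \<Rightarrow> bool" where
  "dominated_splitting f A K l \<alpha> k E \<longleftrightarrow>
     1 \<le> l \<and> 0 < \<alpha> \<and> \<alpha> < 1 \<and>
     (\<forall>x\<in>K. direct_sum_decomposition k (\<lambda>i. E i x)) \<and>
     (\<forall>i<k. \<forall>x\<in>K. \<forall>y\<in>K. edim (E i x) = edim (E i y)) \<and>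
     (\<forall>j<k. \<forall>i<j. dominated f A K l \<alpha> (E i) (E j))"

text \<open>Continuity of a field of closed subspaces in the gap topology, that is, norm continuity
  of the orthogonal projections onto them.\<close>

definition continuous_bundle :: "('x::topological_space \<Rightarrow> 'h::{real_inner,banach} set) \<Rightarrow> bool" where
  "continuous_bundle E \<longleftrightarrow>
     (\<exists>P :: 'x \<Rightarrow> 'h \<Rightarrow>\<^sub>L 'h.
        (\<forall>x v. P x v \<in> E x \<and> v - P x v \<in> orthogonal_comp (E x)) \<and> continuous_on UNIV P)"

text \<open>\<open>G 0, \<dots>, G (k - 1)\<close> is the partition of the exponents according to which the
  Oseledets subspaces are grouped. A group may contain infinitely many exponents, whence the
  closure.\<close>

definition oseledets_grouping ::
  "'x measure \<Rightarrow> ('x \<Rightarrow> 'x) \<Rightarrow> ('x \<Rightarrow> 'h::{real_inner,banach} \<Rightarrow>\<^sub>L 'h) \<Rightarrow> nat \<Rightarrow>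
     (nat \<Rightarrow> ereal set) \<Rightarrow> (nat \<Rightarrow> 'x \<Rightarrow> 'h set) \<Rightarrow> bool" where
  "oseledets_grouping M f A k G E \<longleftrightarrow>
     (\<forall>i<k. G i \<noteq> {}) \<and> disjoint_family_on G {..<k} \<and>
     (\<Union>i<k. G i) = lyapunov_exponents M f A \<and>
     (\<forall>i<k. \<forall>x\<in>oseledets_set M f A.
        E i x = closure (span (\<Union>l\<in>G i. oseledets_space f A x l)))"

definition extended_oseledets_ruelle ::
  "'x::topological_space measure \<Rightarrow> ('x \<Rightarrow> 'x) \<Rightarrow> ('x \<Rightarrow> 'h::{real_inner,banach} \<Rightarrow>\<^sub>L 'h) \<Rightarrow>
     nat \<Rightarrow> real \<Rightarrow> nat \<Rightarrow> (nat \<Rightarrow> ereal set) \<Rightarrow> (nat \<Rightarrow> 'x \<Rightarrow> 'h set) \<Rightarrow> bool" where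
  "extended_oseledets_ruelle M f A l \<alpha> k G E \<longleftrightarrow>
     oseledets_grouping M f A k G E \<and>
     dominated_splitting f A (oseledets_set M f A) l \<alpha> k E \<and>
     dominated_splitting f A UNIV l \<alpha> k E \<and>
     (\<forall>i<k. continuous_bundle (E i))"

section \<open>Partial hyperbolicity\<close>

text \<open>\<open>Iu\<close>, \<open>Ic\<close>, \<open>Is\<close> tell which members of the extended decomposition make up
  \<open>Eu\<close>, \<open>Ec\<close>, \<open>Es\<close>; each of them may be empty, giving the zero bundle.\<close>

definition partially_hyperbolic_splitting ::
  "'x::topological_space measure \<Rightarrow> ('x \<Rightarrow> 'x) \<Rightarrow> ('x \<Rightarrow> 'h::{real_inner,banach} \<Rightarrow>\<^sub>L 'h) \<Rightarrow>
     ('x \<Rightarrow> 'h set) \<Rightarrow> ('x \<Rightarrow> 'h set) \<Rightarrow> ('x \<Rightarrow> 'h set) \<Rightarrow> bool" where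
  "partially_hyperbolic_splitting M f A Eu Ec Es \<longleftrightarrow>
     (\<exists>l0 \<alpha>0 k G E Iu Ic Is.
        extended_oseledets_ruelle M f A l0 \<alpha>0 k G E \<and>
        Iu \<union> Ic \<union> Is = {..<k} \<and> Iu \<inter> Ic = {} \<and> Iu \<inter> Is = {} \<and> Ic \<inter> Is = {} \<and>
        (\<forall>x. Eu x = span (\<Union>i\<in>Iu. E i x) \<and>
             Ec x = span (\<Union>i\<in>Ic. E i x) \<and>
             Es x = span (\<Union>i\<in>Is. E i x)) \<and>
        (\<forall>i\<in>Iu. \<forall>l\<in>G i. 0 < l) \<and>
        (\<forall>i<k. 0 \<in> G i \<longrightarrow> i \<in> Ic) \<and>
        (\<forall>i\<in>Is. \<forall>l\<in>G i. l < 0) \<and>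
        (\<forall>i<k. -\<infinity> \<in> G i \<longrightarrow> i \<in> Is)) \<and>
     (\<exists>l \<alpha> \<beta>. 1 \<le> l \<and> 0 < \<alpha> \<and> \<alpha> < 1 \<and> 0 < \<beta> \<and> \<beta> < 1 \<and>
        dominated f A UNIV l \<alpha> Eu Ec \<and> dominated f A UNIV l \<beta> Ec Es)"

definition partially_hyperbolic ::
  "'x::topological_space measure \<Rightarrow> ('x \<Rightarrow> 'x) \<Rightarrow> ('x \<Rightarrow> 'h::{real_inner,banach} \<Rightarrow>\<^sub>L 'h) \<Rightarrow> bool" where
  "partially_hyperbolic M f A \<longleftrightarrow>
     (\<exists>Eu Ec Es. partially_hyperbolic_splitting M f A Eu Ec Es)"

definition partially_hyperbolic_nontrivial_unstable ::
  "'x::topological_space measure \<Rightarrow> ('x \<Rightarrow> 'x) \<Rightarrow> ('x \<Rightarrow> 'h::{real_inner,banach} \<Rightarrow>\<^sub>L 'h) \<Rightarrow> bool" where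
  "partially_hyperbolic_nontrivial_unstable M f A \<longleftrightarrow>
     (\<exists>Eu Ec Es. partially_hyperbolic_splitting M f A Eu Ec Es \<and> (\<forall>x. Eu x \<noteq> {0}))"

definition nonuniformly_anosov ::
  "'x::topological_space measure \<Rightarrow> ('x \<Rightarrow> 'x) \<Rightarrow> ('x \<Rightarrow> 'h::{real_inner,banach} \<Rightarrow>\<^sub>L 'h) \<Rightarrow> bool" where
  "nonuniformly_anosov M f A \<longleftrightarrow>
     partially_hyperbolic M f A \<and> 0 \<notin> lyapunov_exponents M f A"

end

theory Submission
  imports Defs
begin

text \<open>
  Multiplying a cocycle by a constant \<open>exp d\<close> multiplies its Lyapunov operators by \<open>exp d\<close>, so
  it adds \<open>d\<close> to every Lyapunov exponent and keeps all Oseledets subspaces and all dominated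
  splittings. The Lyapunov operators being compact, the negative exponents do not accumulate at
  \<open>0\<close>; hence for small \<open>d > 0\<close> no negative exponent reaches \<open>0\<close>, the exponent \<open>0\<close> becomes
  positive, and the signs of all other exponents are unchanged.
\<close>

section \<open>Adjoints\<close>

text \<open>The representing vector minimizes \<open>J\<close>; minimizing sequences are Cauchy by the
  parallelogram law.\<close>

lemma riesz_representation:
  fixes \<phi> :: "'h::{real_inner,banach} \<Rightarrow> real"
  assumes "bounded_linear \<phi>"
  shows "\<exists>w. \<forall>x. \<phi> x = inner x w"
proof -
  interpret \<phi>: bounded_linear \<phi> by fact
  \<comment> \<open>Completing the square explains this functional: if \<open>w\<close> represents
    \<phi>, then \<open>J x\<close> is the squared distance from \<open>x\<close> to
    \<open>w\<close> minus the squared norm of \<open>w\<close>.\<close>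
  define J where "J x = (norm x)\<^sup>2 - 2 * \<phi> x" for x
  obtain K where K: "\<And>x. norm (\<phi> x) \<le> norm x * K" using \<phi>.bounded by blast
  have lower: "- K\<^sup>2 \<le> J x" for x
  proof -
    have "\<phi> x \<le> norm x * K" using K[of x] by auto
    moreover have "0 \<le> (norm x - K)\<^sup>2" by simp
    ultimately show ?thesis unfolding J_def power2_diff by (simp add: algebra_simps)
  qed
  define m where "m = (INF x. J x)"
  have bdd: "bdd_below (range J)" using lower by (auto intro!: bdd_belowI)
  have m_le: "m \<le> J x" for x unfolding m_def by (rule cINF_lower[OF bdd]) simp
  have "\<exists>x. J x < m + 1 / real (Suc n)" for n
  proof -
    have "Inf (range J) < m + 1 / real (Suc n)" unfolding m_def by simp
    then show ?thesis using cInf_less_iff[OF _ bdd] by blast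
  qed
  then obtain s where s: "\<And>n. J (s n) < m + 1 / real (Suc n)" by metis
  \<comment> \<open>The linear parts cancel when \<open>J\<close> is evaluated at the midpoint
    \<open>z\<close>, so the parallelogram law applies; \<open>J z\<close> is at least
    \<open>m\<close>, hence near-minimizers are close together.\<close>
  have par: "(norm (x - y))\<^sup>2 \<le> 2 * (J x - m) + 2 * (J y - m)" for x y
  proof -
    define z where "z = (1/2) *\<^sub>R (x + y)"
    have "(norm (x - y))\<^sup>2 = 2 * J x + 2 * J y - 4 * J z"
      by (simp add: J_def z_def power_mult_distrib power2_norm_eq_inner inner_diff inner_add
          inner_commute \<phi>.add \<phi>.scaleR field_simps)
    with m_le[of z] show ?thesis by (simp add: algebra_simps)
  qed
  have "Cauchy s"
  proof (rule metric_CauchyI)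
    fix e :: real assume "0 < e"
    then obtain N where N: "1 / real (Suc N) < e\<^sup>2 / 4"
      using nat_approx_posE[of "e\<^sup>2 / 4"] by (metis half_gt_zero_iff zero_less_divide_iff zero_less_numeral zero_less_power)
    have small: "J (s n) - m < e\<^sup>2 / 4" if "n \<ge> N" for n
    proof -
      have "1 / real (Suc n) \<le> 1 / real (Suc N)" using that by (simp add: frac_le)
      with s[of n] N show ?thesis by linarith
    qed
    have "dist (s i) (s j) < e" if "i \<ge> N" "j \<ge> N" for i j
    proof -
      have "(norm (s i - s j))\<^sup>2 < e\<^sup>2"
        using par[of "s i" "s j"] small[OF that(1)] small[OF that(2)] by argo
      then show ?thesis using \<open>0 < e\<close> by (simp add: dist_norm power2_less_imp_less)
    qed
    then show "\<exists>N. \<forall>i\<ge>N. \<forall>j\<ge>N. dist (s i) (s j) < e" by blast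
  qed
  then obtain w where w: "s \<longlonglongrightarrow> w" by (auto simp: Cauchy_convergent_iff convergent_def)
  have "(\<lambda>n. J (s n)) \<longlonglongrightarrow> J w"
    unfolding J_def by (intro tendsto_intros w \<phi>.tendsto)
  moreover have "(\<lambda>n. m + 1 / real (Suc n)) \<longlonglongrightarrow> m + 0"
    by (intro tendsto_intros LIMSEQ_Suc[OF lim_1_over_n])
  ultimately have "J w \<le> m"
    using LIMSEQ_le[of "\<lambda>n. J (s n)" "J w" "\<lambda>n. m + 1 / real (Suc n)"] s
    by (auto intro: less_imp_le)
  have "\<phi> v = inner v w" for v
  proof (cases "v = 0")
    case False
    define b where "b = inner v w - \<phi> v"
    \<comment> \<open>The vertex of the parabola \<open>J (w + t *\<^sub>R v)\<close> in
      \<open>t\<close>; moving there would lower \<open>J\<close> by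
      \<open>b\<^sup>2 / inner v v\<close>, so minimality of \<open>w\<close> forces
      \<open>b = 0\<close>.\<close>
    define t where "t = - b / inner v v"
    have pos: "0 < inner v v" using False by simp
    have "J w \<le> J (w + t *\<^sub>R v)" using m_le \<open>J w \<le> m\<close> by (rule order_trans[rotated])
    also have "\<dots> = J w + 2 * t * b + t * t * inner v v"
      by (simp add: J_def b_def power2_norm_eq_inner inner_add inner_commute \<phi>.add \<phi>.scaleR
          algebra_simps)
    also have "\<dots> = J w - b\<^sup>2 / inner v v"
      using pos by (simp add: t_def power2_eq_square field_simps)
    finally have "b\<^sup>2 / inner v v \<le> 0" by simp
    with pos have "b\<^sup>2 \<le> 0" by (meson divide_le_0_iff not_less order_less_le_trans)
    then show ?thesis by (simp add: b_def)
  qed (simp add: \<phi>.zero)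
  then show ?thesis by blast
qed

text \<open>The constant \<open>adjoint\<close> is defined by choice and has its characteristic
  property only once some adjoint exists; Riesz representation provides one.\<close>

lemma inner_adjoint_blinfun:
  fixes T :: "'h::{real_inner,banach} \<Rightarrow>\<^sub>L 'h"
  shows "inner (T x) y = inner x (adjoint (blinfun_apply T) y)"
proof -
  have "\<exists>w. \<forall>x. inner (T x) y = inner x w" for y
    by (rule riesz_representation) (intro bounded_linear_intros)
  then obtain g where g: "\<forall>x y. inner (T x) y = inner x (g y)" by metis
  then show ?thesis using adjoint_unique[OF g] by simp
qed

lemma adjoint_scaleR_blinfun:
  fixes T :: "'h::{real_inner,banach} \<Rightarrow>\<^sub>L 'h"
  shows "adjoint (blinfun_apply (c *\<^sub>R T)) = (\<lambda>y. c *\<^sub>R adjoint (blinfun_apply T) y)"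
  by (rule adjoint_unique) (simp add: scaleR_blinfun.rep_eq inner_adjoint_blinfun)

section \<open>Scaled cocycles\<close>

lemma compact_operator_scaleR:
  assumes "compact_operator T"
  shows "compact_operator (c *\<^sub>R T)"
  unfolding compact_operator_def
proof (intro allI impI)
  fix B :: "'a set" assume "bounded B"
  then have "compact ((\<lambda>v. c *\<^sub>R v) ` closure (T ` B))"
    using assms by (auto simp: compact_operator_def intro: compact_scaling)
  moreover have "(c *\<^sub>R T) ` B = (\<lambda>v. c *\<^sub>R v) ` T ` B"
    by (simp add: scaleR_blinfun.rep_eq image_image)
  ultimately show "compact (closure ((c *\<^sub>R T) ` B))"
    by (simp add: closure_scaleR)
qed

section \<open>Lyapunov operators under scaling\<close>

lemma cocycle_iterate_scaleR:
  "cocycle_iterate f (\<lambda>x. c *\<^sub>R A x) n x = c ^ n *\<^sub>R cocycle_iterate f A n x"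
  by (induction n) (auto intro!: blinfun_eqI simp: scaleR_blinfun.rep_eq blinfun.scaleR_right)

lemma funpow_scaleR_blinfun:
  fixes T :: "'h::real_normed_vector \<Rightarrow>\<^sub>L 'h"
  shows "(blinfun_apply (c *\<^sub>R T) ^^ n) v = c ^ n *\<^sub>R (blinfun_apply T ^^ n) v"
  by (induction n) (auto simp: scaleR_blinfun.rep_eq blinfun.scaleR_right)

text \<open>Scaling contributes \<open>c ^ n\<close> to the iterate and again to its adjoint, and
  the \<open>2n\<close>-th root turns the product into a single \<open>c\<close>. Positivity of
  \<open>c\<close> keeps the new roots positive.\<close>

lemma lyapunov_limit_scaleR:
  assumes "0 < c" "lyapunov_limit f A x L"
  shows "lyapunov_limit f (\<lambda>x. c *\<^sub>R A x) x (c *\<^sub>R L)"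
proof -
  obtain R where pos: "\<And>n. n \<ge> 1 \<Longrightarrow> positive_operator (R n)"
    and root: "\<And>n. n \<ge> 1 \<Longrightarrow> blinfun_apply (R n) ^^ (2 * n) =
          adjoint (blinfun_apply (cocycle_iterate f A n x)) \<circ> blinfun_apply (cocycle_iterate f A n x)"
    and lim: "R \<longlonglongrightarrow> L"
    using assms(2) unfolding lyapunov_limit_def by blast
  show ?thesis
    unfolding lyapunov_limit_def
  proof (intro exI[of _ "\<lambda>n. c *\<^sub>R R n"] conjI allI impI)
    fix n :: nat assume n: "n \<ge> 1"
    show "positive_operator (c *\<^sub>R R n)"
      using pos[OF n] assms(1) by (auto simp: positive_operator_def scaleR_blinfun.rep_eq)
    let ?T = "cocycle_iterate f A n x"
    \<comment> \<open>Here \<open>adjoint\<close> yields a bare function, so its homogeneity is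
      obtained by testing against all \<open>z\<close>.\<close>
    have lin: "adjoint (blinfun_apply ?T) (r *\<^sub>R v) = r *\<^sub>R adjoint (blinfun_apply ?T) v" for r v
    proof -
      have "inner z (adjoint (blinfun_apply ?T) (r *\<^sub>R v)) = inner z (r *\<^sub>R adjoint (blinfun_apply ?T) v)"
        for z by (simp flip: inner_adjoint_blinfun)
      then show ?thesis using vector_eq_ldot by blast
    qed
    show "blinfun_apply (c *\<^sub>R R n) ^^ (2 * n) =
        adjoint (blinfun_apply (cocycle_iterate f (\<lambda>x. c *\<^sub>R A x) n x)) \<circ>
        blinfun_apply (cocycle_iterate f (\<lambda>x. c *\<^sub>R A x) n x)"
    proof
      fix v
      have "adjoint (blinfun_apply (c ^ n *\<^sub>R ?T)) ((c ^ n *\<^sub>R ?T) v) =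
          c ^ (2 * n) *\<^sub>R adjoint (blinfun_apply ?T) (?T v)"
        unfolding adjoint_scaleR_blinfun by (simp add: scaleR_blinfun.rep_eq lin mult_2 power_add)
      then show "(blinfun_apply (c *\<^sub>R R n) ^^ (2 * n)) v =
          (adjoint (blinfun_apply (cocycle_iterate f (\<lambda>x. c *\<^sub>R A x) n x)) \<circ>
            blinfun_apply (cocycle_iterate f (\<lambda>x. c *\<^sub>R A x) n x)) v"
        unfolding funpow_scaleR_blinfun root[OF n] cocycle_iterate_scaleR o_apply by (rule sym)
    qed
  qed (intro tendsto_intros lim)
qed

lemma lyapunov_limit_scaleR_iff:
  assumes "0 < c"
  shows "lyapunov_limit f (\<lambda>x. c *\<^sub>R A x) x L \<longleftrightarrow> lyapunov_limit f A x (inverse c *\<^sub>R L)"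
proof
  assume "lyapunov_limit f (\<lambda>x. c *\<^sub>R A x) x L"
  from lyapunov_limit_scaleR[OF _ this, of "inverse c"] assms
  show "lyapunov_limit f A x (inverse c *\<^sub>R L)" by simp
next
  assume "lyapunov_limit f A x (inverse c *\<^sub>R L)"
  from lyapunov_limit_scaleR[OF assms this] assms
  show "lyapunov_limit f (\<lambda>x. c *\<^sub>R A x) x L" by simp
qed

text \<open>Since \<open>lyapunov_operator\<close> is a definite description, uniqueness has to be
  transported along with existence. Any limit for the scaled cocycle, multiplied by
  \<open>inverse c\<close>, is a limit for \<open>A\<close> and so equals \<open>L\<close>.\<close>

lemma has_lyapunov_operator_scaleR_imp:
  assumes "0 < c" "has_lyapunov_operator f A x"
  shows "has_lyapunov_operator f (\<lambda>x. c *\<^sub>R A x) x"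
    and "lyapunov_operator f (\<lambda>x. c *\<^sub>R A x) x = c *\<^sub>R lyapunov_operator f A x"
proof -
  define L where "L = lyapunov_operator f A x"
  have ex: "\<exists>!L. lyapunov_limit f A x L" and "compact_operator L"
    using assms(2) by (auto simp: has_lyapunov_operator_def L_def)
  have L: "lyapunov_limit f A x L"
    unfolding L_def lyapunov_operator_def by (rule theI'[OF ex])
  have uniq: "L' = c *\<^sub>R L" if "lyapunov_limit f (\<lambda>x. c *\<^sub>R A x) x L'" for L'
  proof -
    have "L = inverse c *\<^sub>R L'"
      unfolding L_def lyapunov_operator_def
      by (rule the1_equality[OF ex iffD1[OF lyapunov_limit_scaleR_iff[OF assms(1)] that]])
    then show ?thesis using assms(1) by simp
  qed
  have L': "lyapunov_limit f (\<lambda>x. c *\<^sub>R A x) x (c *\<^sub>R L)"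
    by (rule lyapunov_limit_scaleR[OF assms(1) L])
  show eq: "lyapunov_operator f (\<lambda>x. c *\<^sub>R A x) x = c *\<^sub>R lyapunov_operator f A x"
    unfolding L_def[symmetric] unfolding lyapunov_operator_def
    by (rule the_equality) (rule L', rule uniq)
  show "has_lyapunov_operator f (\<lambda>x. c *\<^sub>R A x) x"
    unfolding has_lyapunov_operator_def eq
  proof
    show "\<exists>!L. lyapunov_limit f (\<lambda>x. c *\<^sub>R A x) x L"
      by (rule ex1I) (rule L', rule uniq)
    show "compact_operator (c *\<^sub>R lyapunov_operator f A x)"
      using \<open>compact_operator L\<close> unfolding L_def by (rule compact_operator_scaleR)
  qed
qed

lemma has_lyapunov_operator_scaleR:
  assumes "0 < c"
  shows "has_lyapunov_operator f (\<lambda>x. c *\<^sub>R A x) x \<longleftrightarrow> has_lyapunov_operator f A x"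
proof
  assume "has_lyapunov_operator f (\<lambda>x. c *\<^sub>R A x) x"
  from has_lyapunov_operator_scaleR_imp(1)[OF _ this, of "inverse c"] assms
  show "has_lyapunov_operator f A x" by simp
qed (rule has_lyapunov_operator_scaleR_imp(1)[OF assms])

section \<open>Exponents, regular points and Oseledets subspaces under the shift\<close>

lemma oseledets_space_scaleR:
  assumes "has_lyapunov_operator f A x" "l < \<infinity>"
  shows "oseledets_space f (\<lambda>x. exp d *\<^sub>R A x) x (l + ereal d) = oseledets_space f A x l"
proof -
  have "exp d *\<^sub>R w = exp (r + d) *\<^sub>R v \<longleftrightarrow> w = exp r *\<^sub>R v" for r and v w :: 'b
  proof -
    have eq: "exp (r + d) *\<^sub>R v = exp d *\<^sub>R exp r *\<^sub>R v" by (simp add: exp_add)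
    show ?thesis unfolding eq scaleR_cancel_left by simp
  qed
  \<comment> \<open>At -\<infinity> the shift is absorbed and both spaces are the kernel. The label
    \<infinity> must be excluded: it would be read as eigenvalue 1 on both sides, which scaling does
    not preserve.\<close>
  then show ?thesis
    using assms has_lyapunov_operator_scaleR_imp(2)[OF _ assms(1), of "exp d"]
    by (cases l) (auto simp: oseledets_space_def scaleR_blinfun.rep_eq)
qed

text \<open>The shift maps the labels below \<infinity> onto themselves, so quantifiers over labels
  can be reindexed by it.\<close>

lemma ereal_shift_cases:
  assumes "l < \<infinity>"
  obtains l' where "l' < \<infinity>" "l = l' + ereal d"
proof
  show "l + ereal (- d) < \<infinity>" using assms by (cases l) auto
  show "l = l + ereal (- d) + ereal d" by (cases l) auto
qed

lemma lyapunov_exponents_scaleR: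
  "lyapunov_exponents M f (\<lambda>x. exp d *\<^sub>R A x) = (\<lambda>l. l + ereal d) ` lyapunov_exponents M f A"
    (is "?L = ?R")
proof -
  \<comment> \<open>The conditions under the two \<open>AE\<close> quantifiers agree at every single
    point, so no exceptional null set enters.\<close>
  have shift: "l + ereal d \<in> ?L \<longleftrightarrow> l \<in> lyapunov_exponents M f A" if "l < \<infinity>" for l
  proof -
    have "l + ereal d < \<infinity>" using that by (cases l) auto
    moreover have "(has_lyapunov_operator f (\<lambda>x. exp d *\<^sub>R A x) x \<and>
          oseledets_space f (\<lambda>x. exp d *\<^sub>R A x) x (l + ereal d) \<noteq> {0}) \<longleftrightarrow>
        (has_lyapunov_operator f A x \<and> oseledets_space f A x l \<noteq> {0})" for x
      using oseledets_space_scaleR[OF _ that, of f A x d] has_lyapunov_operator_scaleR[of "exp d" f A x]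
      by simp metis
    ultimately show ?thesis
      using that by (simp only: lyapunov_exponents_def mem_Collect_eq)
  qed
  show ?thesis
  proof (intro equalityI subsetI)
    fix l assume "l \<in> ?L"
    then have "l < \<infinity>" by (simp add: lyapunov_exponents_def)
    then obtain l' where "l' < \<infinity>" "l = l' + ereal d" by (rule ereal_shift_cases)
    with shift \<open>l \<in> ?L\<close> show "l \<in> ?R" by blast
  next
    fix l assume "l \<in> ?R"
    then obtain l' where "l = l' + ereal d" "l' \<in> lyapunov_exponents M f A" by blast
    with shift show "l \<in> ?L" by (auto simp: lyapunov_exponents_def)
  qed
qed

lemma regular_point_scaleR:
  "regular_point M f (\<lambda>x. exp d *\<^sub>R A x) x \<longleftrightarrow> regular_point M f A x"
proof -
  let ?C = "\<lambda>x. exp d *\<^sub>R A x"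
  \<comment> \<open>Relating the spaces at \<open>x\<close> requires a Lyapunov operator there;
    hence the equivalence is conditional and is joined to the first conjunct by
    \<open>conj_cong\<close>.\<close>
  have eq: "(\<forall>l<\<infinity>. AE y in M. has_lyapunov_operator f ?C y \<and>
            edim (oseledets_space f ?C y l) = edim (oseledets_space f ?C x l)) \<longleftrightarrow>
        (\<forall>l<\<infinity>. AE y in M. has_lyapunov_operator f A y \<and>
            edim (oseledets_space f A y l) = edim (oseledets_space f A x l))"
    (is "(\<forall>l<\<infinity>. ?P l) \<longleftrightarrow> (\<forall>l<\<infinity>. ?Q l)") if x: "has_lyapunov_operator f A x"
  proof -
    have shift: "?P (l + ereal d) \<longleftrightarrow> ?Q l" if "l < \<infinity>" for l
    proof -
      have "(has_lyapunov_operator f ?C y \<and>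
            edim (oseledets_space f ?C y (l + ereal d)) = edim (oseledets_space f ?C x (l + ereal d))) \<longleftrightarrow>
        (has_lyapunov_operator f A y \<and>
            edim (oseledets_space f A y l) = edim (oseledets_space f A x l))" for y
        using oseledets_space_scaleR[OF _ that, of f A y d] oseledets_space_scaleR[OF x that, of d]
        by (auto simp: has_lyapunov_operator_scaleR)
      then show ?thesis by simp
    qed
    show ?thesis
    proof (intro iffI allI impI)
      fix l :: ereal
      assume all: "\<forall>l<\<infinity>. ?P l" and "l < \<infinity>"
      then have "l + ereal d < \<infinity>" by (cases l) auto
      then have "?P (l + ereal d)" by (rule all[THEN spec, THEN mp])
      then show "?Q l" by (rule iffD1[OF shift[OF \<open>l < \<infinity>\<close>]])
    next
      fix l :: ereal
      assume all: "\<forall>l<\<infinity>. ?Q l" and "l < \<infinity>"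
      obtain l' where l': "l' < \<infinity>" "l = l' + ereal d"
        using \<open>l < \<infinity>\<close> by (rule ereal_shift_cases)
      have "?Q l'" using l'(1) by (rule all[THEN spec, THEN mp])
      then have "?P (l' + ereal d)" by (rule iffD2[OF shift[OF l'(1)]])
      then show "?P l" by (simp only: l'(2))
    qed
  qed
  show ?thesis
    unfolding regular_point_def
    by (rule conj_cong[OF has_lyapunov_operator_scaleR[OF exp_gt_zero] eq])
qed

lemma oseledets_set_scaleR:
  "oseledets_set M f (\<lambda>x. exp d *\<^sub>R A x) = oseledets_set M f A"
  by (simp add: oseledets_set_def regular_point_scaleR)

lemma oseledets_grouping_scaleR:
  assumes "oseledets_grouping M f A k G E"
  shows "oseledets_grouping M f (\<lambda>x. exp d *\<^sub>R A x) k (\<lambda>i. (\<lambda>l. l + ereal d) ` G i) E"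
proof -
  let ?C = "\<lambda>x. exp d *\<^sub>R A x"
  have G: "(\<Union>i<k. G i) = lyapunov_exponents M f A" "disjoint_family_on G {..<k}"
    using assms by (auto simp: oseledets_grouping_def)
  \<comment> \<open>Injectivity of a finite shift keeps the groups disjoint; the bundles
    \<open>E\<close> stay the same and only their labels move.\<close>
  have "inj (\<lambda>l. l + ereal d)" by (auto simp: inj_def ereal_add_cancel_right)
  then have "disjoint_family_on (\<lambda>i. (\<lambda>l. l + ereal d) ` G i) {..<k}"
    using G(2) by (auto simp: disjoint_family_on_def simp flip: image_Int)
  moreover have "(\<Union>i<k. (\<lambda>l. l + ereal d) ` G i) = lyapunov_exponents M f ?C"
    by (simp add: lyapunov_exponents_scaleR image_UN flip: G(1))
  moreover have "E i x = closure (span (\<Union>l\<in>(\<lambda>l. l + ereal d) ` G i. oseledets_space f ?C x l))"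
    if "i < k" "x \<in> oseledets_set M f ?C" for i x
  proof -
    have x: "x \<in> oseledets_set M f A" using that by (simp add: oseledets_set_scaleR)
    \<comment> \<open>Time 0 of the orbit condition gives regularity of \<open>x\<close>
      itself.\<close>
    then have "regular_point M f A ((f ^^ 0) x)" unfolding oseledets_set_def by blast
    then have "has_lyapunov_operator f A x" by (simp add: regular_point_def)
    moreover have "l < \<infinity>" if "l \<in> G i" for l
      using that \<open>i < k\<close> G(1) by (auto simp: lyapunov_exponents_def)
    ultimately have "(\<Union>l\<in>(\<lambda>l. l + ereal d) ` G i. oseledets_space f ?C x l) =
        (\<Union>l\<in>G i. oseledets_space f A x l)"
      by (simp add: oseledets_space_scaleR)
    then show ?thesis using assms that x by (simp add: oseledets_grouping_def)
  qed
  ultimately show ?thesis using assms by (auto simp: oseledets_grouping_def)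
qed

section \<open>Domination under scaling\<close>

lemma dominated_scaleR:
  assumes "0 < c" "dominated f A K l \<alpha> E1 E2"
  shows "dominated f (\<lambda>x. c *\<^sub>R A x) K l \<alpha> E1 E2"
proof -
  note D = assms(2)[unfolded dominated_def]
  note K = D[THEN conjunct1]
    and sub = D[THEN conjunct2, THEN conjunct1]
    and inv = D[THEN conjunct2, THEN conjunct2, THEN conjunct1]
    and dims = D[THEN conjunct2, THEN conjunct2, THEN conjunct2, THEN conjunct1]
    and ex = D[THEN conjunct2, THEN conjunct2, THEN conjunct2, THEN conjunct2]
  from ex obtain \<theta> where "0 < \<theta>"
    and \<theta>: "\<And>x u v. x \<in> K \<Longrightarrow> u \<in> E2 x \<Longrightarrow> v \<in> E1 x \<Longrightarrow> norm u = 1 \<Longrightarrow> norm v = 1 \<Longrightarrow>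
        \<theta> \<le> norm (A x v) \<and>
        norm (cocycle_iterate f A l x u) \<le> \<alpha> * norm (cocycle_iterate f A l x v)"
    by metis
  have inv': "(c *\<^sub>R A x) ` E1 x \<subseteq> E1 (f x) \<and> (c *\<^sub>R A x) ` E2 x \<subseteq> E2 (f x)" if x: "x \<in> K" for x
  proof -
    \<comment> \<open>Scaled images stay in the fibres over \<open>f x\<close> because these are
      subspaces, which is known only for points of \<open>K\<close>.\<close>
    have "f x \<in> K" using K x by blast
    then have "subspace (E1 (f x))" "subspace (E2 (f x))" using sub by auto
    moreover have "A x v \<in> E1 (f x)" if "v \<in> E1 x" for v using inv x that by blast
    moreover have "A x v \<in> E2 (f x)" if "v \<in> E2 x" for v using inv x that by blast
    ultimately show ?thesis by (auto simp: scaleR_blinfun.rep_eq subspace_scale)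
  qed
  have "c * \<theta> \<le> norm ((c *\<^sub>R A x) v) \<and>
      norm (cocycle_iterate f (\<lambda>x. c *\<^sub>R A x) l x u)
        \<le> \<alpha> * norm (cocycle_iterate f (\<lambda>x. c *\<^sub>R A x) l x v)"
    if "x \<in> K" "u \<in> E2 x" "v \<in> E1 x" "norm u = 1" "norm v = 1" for x u v
  proof -
    \<comment> \<open>Both sides of the growth comparison acquire the same factor, so
      \<open>l\<close> and \<alpha> survive; only the lower bound \<theta> has to be
      rescaled.\<close>
    have "c ^ l * norm (cocycle_iterate f A l x u) \<le> c ^ l * (\<alpha> * norm (cocycle_iterate f A l x v))"
      using \<theta>[OF that] assms(1) by (intro mult_left_mono) auto
    then show ?thesis
      using \<theta>[OF that] assms(1)
      by (simp add: scaleR_blinfun.rep_eq cocycle_iterate_scaleR mult.left_commute)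
  qed
  moreover have "0 < c * \<theta>" using assms(1) \<open>0 < \<theta>\<close> by simp
  ultimately show ?thesis
    unfolding dominated_def
    by (intro conjI K sub dims ballI exI[of _ "c * \<theta>"] impI) (use inv' in blast)+
qed

lemma dominated_splitting_scaleR:
  assumes "0 < c" "dominated_splitting f A K l \<alpha> k E"
  shows "dominated_splitting f (\<lambda>x. c *\<^sub>R A x) K l \<alpha> k E"
proof -
  have "\<forall>j<k. \<forall>i<j. dominated f A K l \<alpha> (E i) (E j)"
    using assms(2) unfolding dominated_splitting_def by (elim conjE)
  then have "\<forall>j<k. \<forall>i<j. dominated f (\<lambda>x. c *\<^sub>R A x) K l \<alpha> (E i) (E j)"
    by (intro allI impI dominated_scaleR[OF assms(1)]) simp
  then show ?thesis
    using assms(2) unfolding dominated_splitting_def by (elim conjE) (intro conjI; assumption)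
qed

lemma extended_oseledets_ruelle_scaleR:
  assumes "extended_oseledets_ruelle M f A l \<alpha> k G E"
  shows "extended_oseledets_ruelle M f (\<lambda>x. exp d *\<^sub>R A x) l \<alpha> k (\<lambda>i. (\<lambda>l. l + ereal d) ` G i) E"
  using assms unfolding extended_oseledets_ruelle_def oseledets_set_scaleR
  by (elim conjE)
    (intro conjI oseledets_grouping_scaleR dominated_splitting_scaleR[OF exp_gt_zero]; assumption)

section \<open>Discreteness of the spectrum\<close>

text \<open>Symmetry passes from the positive roots to their limit. It is what makes eigenvectors
  for distinct eigenvalues orthogonal.\<close>

lemma lyapunov_operator_symmetric:
  assumes "has_lyapunov_operator f A x"
  shows "inner (lyapunov_operator f A x u) v = inner u (lyapunov_operator f A x v)"
proof -
  have "\<exists>!L. lyapunov_limit f A x L" using assms by (simp add: has_lyapunov_operator_def)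
  then have "lyapunov_limit f A x (lyapunov_operator f A x)"
    unfolding lyapunov_operator_def by (rule theI')
  then obtain R where R: "\<And>n. n \<ge> 1 \<Longrightarrow> positive_operator (R n)"
    and lim: "R \<longlonglongrightarrow> lyapunov_operator f A x"
    unfolding lyapunov_limit_def by blast
  have lim1: "(\<lambda>n. inner (R n u) v) \<longlonglongrightarrow> inner (lyapunov_operator f A x u) v"
    by (intro tendsto_intros lim)
  have lim': "(\<lambda>n. inner u (R n v)) \<longlonglongrightarrow> inner u (lyapunov_operator f A x v)"
    by (intro tendsto_intros lim)
  \<comment> \<open>Nothing is known about \<open>R 0\<close>, so the two sequences are compared
    only from index 1 on.\<close>
  have "eventually (\<lambda>n. inner u (R n v) = inner (R n u) v) sequentially"
    using eventually_ge_at_top[of 1] by eventually_elim (use R in \<open>auto simp: positive_operator_def\<close>)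
  then have "(\<lambda>n. inner (R n u) v) \<longlonglongrightarrow> inner u (lyapunov_operator f A x v)"
    by (rule Lim_transform_eventually[OF lim'])
  with lim1 show ?thesis by (rule LIMSEQ_unique)
qed

text \<open>Normalized eigenvectors for distinct eigenvalues of size at least \<open>r\<close> have images at
  mutual distance at least \<open>r\<close>.\<close>

lemma finite_large_eigenvalues:
  fixes L :: "'h::real_inner \<Rightarrow>\<^sub>L 'h"
  assumes "compact_operator L" and sym: "\<And>u v. inner (L u) v = inner u (L v)" and "0 < r"
  shows "finite {a. r \<le> a \<and> (\<exists>v. v \<noteq> 0 \<and> L v = a *\<^sub>R v)}" (is "finite ?S")
proof (rule ccontr)
  assume "infinite ?S"
  then obtain a :: "nat \<Rightarrow> real" where a: "inj a" "range a \<subseteq> ?S"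
    by (auto dest: infinite_countable_subset)
  have aS: "a n \<in> ?S" for n by (rule subsetD[OF a(2) rangeI])
  have "\<exists>v. norm v = 1 \<and> L v = a n *\<^sub>R v" for n
  proof -
    from aS[of n] obtain v where "v \<noteq> 0" "L v = a n *\<^sub>R v" by auto
    then show ?thesis
      by (intro exI[of _ "v /\<^sub>R norm v"]) (simp add: blinfun.scaleR_right)
  qed
  then obtain v where v: "\<And>n. norm (v n) = 1" "\<And>n. L (v n) = a n *\<^sub>R v n" by metis
  have ge: "r \<le> a n" for n using aS[of n] by simp
  have apart: "r \<le> dist (L (v i)) (L (v j))" if "i \<noteq> j" for i j
  proof -
    \<comment> \<open>Moving \<open>L\<close> across the inner product gives orthogonality, after
      which Pythagoras computes the distance of the images.\<close>
    have "a i * inner (v i) (v j) = a j * inner (v i) (v j)"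
      using sym[of "v i" "v j"] by (simp add: v(2))
    moreover have "a i \<noteq> a j" using a(1) that by (auto simp: inj_def)
    ultimately have orth: "inner (v i) (v j) = 0" by simp
    have "(dist (L (v i)) (L (v j)))\<^sup>2 = (a i)\<^sup>2 * inner (v i) (v i) + (a j)\<^sup>2 * inner (v j) (v j)"
      unfolding dist_norm v(2) power2_norm_eq_inner
      by (simp add: inner_diff orth inner_commute[of "v j" "v i"] power2_eq_square)
    also have "\<dots> = (a i)\<^sup>2 + (a j)\<^sup>2" by (simp add: v(1) flip: power2_norm_eq_inner)
    finally have "r\<^sup>2 \<le> (dist (L (v i)) (L (v j)))\<^sup>2"
      using power_mono[OF ge[of i], of 2] assms(3) by (smt (verit) zero_le_power2)
    then show ?thesis by (rule power2_le_imp_le) simp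
  qed
  have "bounded (range v)" unfolding bounded_iff using v(1) by auto
  then have "compact (closure (L ` range v))" using assms(1) by (simp add: compact_operator_def)
  moreover have "\<forall>n. L (v n) \<in> closure (L ` range v)"
    by (intro allI closure_subset[THEN subsetD] imageI rangeI)
  \<comment> \<open>A convergent subsequence of the images would have terms closer than
    \<open>r\<close>, contradicting their separation.\<close>
  ultimately obtain l s where "strict_mono s" "((\<lambda>n. L (v n)) \<circ> s) \<longlonglongrightarrow> l"
    unfolding compact_eq_seq_compact_metric by (rule seq_compactE)
  then have "Cauchy ((\<lambda>n. L (v n)) \<circ> s)" by (intro LIMSEQ_imp_Cauchy)
  then obtain N where "\<forall>i\<ge>N. \<forall>j\<ge>N. dist (L (v (s i))) (L (v (s j))) < r"
    using assms(3) by (auto simp: Cauchy_def)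
  then have "dist (L (v (s N))) (L (v (s (Suc N)))) < r" by simp
  moreover have "s N \<noteq> s (Suc N)" using \<open>strict_mono s\<close> by (simp add: strict_mono_eq)
  ultimately show False using apart by force
qed

text \<open>Each exponent has its own exceptional null set, so the argument selects a sequence of
  exponents: countably many null sets leave a common point, where compactness of the Lyapunov
  operator limits the eigenvalues \<open>exp (t n)\<close>, all at least
  \<open>exp b\<close>.\<close>

lemma finite_lyapunov_exponents_ge:
  assumes "prob_space M"
  shows "finite {t. ereal t \<in> lyapunov_exponents M f A \<and> b \<le> t}" (is "finite ?S")
proof (rule ccontr)
  assume "infinite ?S"
  then obtain t :: "nat \<Rightarrow> real" where t: "inj t" "range t \<subseteq> ?S"
    using infinite_countable_subset by blast
  then have "\<forall>n. AE x in M. has_lyapunov_operator f A x \<and> oseledets_space f A x (ereal (t n)) \<noteq> {0}"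
    by (auto simp: lyapunov_exponents_def)
  then have "AE x in M. \<forall>n. has_lyapunov_operator f A x \<and> oseledets_space f A x (ereal (t n)) \<noteq> {0}"
    by (simp add: AE_all_countable)
  then have "\<exists>x. \<forall>n. has_lyapunov_operator f A x \<and> oseledets_space f A x (ereal (t n)) \<noteq> {0}"
    by (rule eventually_happens'[OF prob_space.ae_filter_bot[OF assms]])
  then obtain x where "\<forall>n. has_lyapunov_operator f A x \<and> oseledets_space f A x (ereal (t n)) \<noteq> {0}"
    by (rule exE)
  then have x: "has_lyapunov_operator f A x"
    and sp: "\<And>n. oseledets_space f A x (ereal (t n)) \<noteq> {0}"
    by simp_all
  let ?L = "lyapunov_operator f A x"
  let ?T = "{a. exp b \<le> a \<and> (\<exists>v. v \<noteq> 0 \<and> ?L v = a *\<^sub>R v)}"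
  have "compact_operator ?L" using x by (simp add: has_lyapunov_operator_def)
  then have "finite ?T"
    using lyapunov_operator_symmetric[OF x] by (intro finite_large_eigenvalues) auto
  moreover have "exp (t n) \<in> ?T" for n
  proof -
    have "0 \<in> oseledets_space f A x (ereal (t n))" by (simp add: oseledets_space_def)
    with sp[of n] obtain v where "v \<noteq> 0" "v \<in> oseledets_space f A x (ereal (t n))" by blast
    moreover have "b \<le> t n" using t(2) by blast
    ultimately show ?thesis by (auto simp: oseledets_space_def)
  qed
  then have "range (\<lambda>n. exp (t n)) \<subseteq> ?T" by blast
  ultimately have "finite (range (\<lambda>n. exp (t n)))" by (rule finite_subset[rotated])
  moreover have "inj (\<lambda>n. exp (t n))" using t(1) by (simp add: inj_def)
  ultimately show False using finite_imageD by blast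
qed

lemma negative_lyapunov_exponents_gap:
  assumes "prob_space M"
  obtains \<delta> where "0 < \<delta>" "\<And>l. l \<in> lyapunov_exponents M f A \<Longrightarrow> l < 0 \<Longrightarrow> l < ereal (- \<delta>)"
proof -
  let ?S = "{t. ereal t \<in> lyapunov_exponents M f A \<and> - 1 \<le> t} \<inter> {..<0}"
  \<comment> \<open>Only finitely many exponents lie in [-1, 0). Inserting -1 makes the maximum
    exist in every case and also covers the exponents below -1.\<close>
  define m where "m = Max (insert (- 1) ?S)"
  have fin: "finite (insert (- 1) ?S)"
    using finite_lyapunov_exponents_ge[OF assms] by blast
  then have "m \<in> insert (- 1) ?S" unfolding m_def by (rule Max_in) simp
  then have "m < 0" by auto
  have le: "t \<le> m" if "t \<in> insert (- 1) ?S" for t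
    unfolding m_def using fin that by (rule Max_ge)
  show thesis
  proof
    \<comment> \<open>Halving makes the gap strict: a negative exponent is at most \<open>m\<close>,
      and \<open>m < m / 2\<close> because \<open>m\<close> is negative.\<close>
    show "0 < - m / 2" using \<open>m < 0\<close> by simp
    fix l assume l: "l \<in> lyapunov_exponents M f A" "l < 0"
    show "l < ereal (- (- m / 2))"
    proof (cases l)
      case (real t)
      then have "t \<le> m" using l le[of t] le[of "-1"] by (cases "- 1 \<le> t") auto
      then show ?thesis using real \<open>m < 0\<close> by simp
    qed (use l in auto)
  qed
qed

section \<open>The perturbation\<close>

text \<open>On a compact space the norm of a continuous cocycle is bounded, so the integrand is
  bounded and measurable on a probability space.\<close>

lemma integrable_cocycle_scaleR:
  assumes "prob_space M" "sets M = sets borel" "compact (UNIV :: 'x set)"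
    and "integrable_cocycle S M (A :: 'x::t2_space \<Rightarrow> _)"
  shows "integrable_cocycle S M (\<lambda>x. c *\<^sub>R A x)"
proof -
  interpret prob_space M by fact
  have cont: "continuous_on UNIV A" using assms(4) by (simp add: integrable_cocycle_def)
  then have cont': "continuous_on UNIV (\<lambda>x. norm (c *\<^sub>R A x))" by (intro continuous_intros)
  then have "bounded (range (\<lambda>x. norm (c *\<^sub>R A x)))"
    using assms(3) compact_continuous_image compact_imp_bounded by blast
  then obtain B where B: "\<And>x. norm (c *\<^sub>R A x) \<le> B" by (auto simp: bounded_iff)
  have "(\<lambda>x. norm (c *\<^sub>R A x)) \<in> borel_measurable M"
    using borel_measurable_continuous_onI[OF cont'] measurable_cong_sets[OF assms(2) refl] by auto
  moreover have "norm (max 0 (ln (norm (c *\<^sub>R A x)))) \<le> max 0 (ln B)" for x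
  proof (cases "c *\<^sub>R A x = 0")
    case False
    then have "ln (norm (c *\<^sub>R A x)) \<le> ln B"
      using B[of x] by (metis ln_mono zero_less_norm_iff)
    then show ?thesis by auto
  qed auto
  ultimately have "integrable M (\<lambda>x. max 0 (ln (norm (c *\<^sub>R A x))))"
    by (intro integrable_const_bound[where B = "max 0 (ln B)"] always_eventually) auto
  moreover have "scalar_linear S (c *\<^sub>R A x)" for x
    using assms(4)
    by (simp add: integrable_cocycle_def scalar_linear_def
        bounded_bilinear.scaleR_left[OF bounded_bilinear_blinfun_compose]
        bounded_bilinear.scaleR_right[OF bounded_bilinear_blinfun_compose])
  ultimately show ?thesis
    using assms(4) cont
    by (auto simp: integrable_cocycle_def compact_operator_scaleR intro!: continuous_intros)
qed

text \<open>The bundles and index sets are reused unchanged. The gap keeps the stable labels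
  negative after the shift, and the positive shift preserves the unstable signs.\<close>

lemma nonuniformly_anosov_scaleR:
  assumes "partially_hyperbolic M f A" "0 < d"
    and gap: "\<And>l. l \<in> lyapunov_exponents M f A \<Longrightarrow> l < 0 \<Longrightarrow> l < ereal (- d)"
  shows "nonuniformly_anosov M f (\<lambda>x. exp d *\<^sub>R A x)"
proof -
  let ?C = "\<lambda>x. exp d *\<^sub>R A x"
  let ?s = "\<lambda>l::ereal. l + ereal d"
  \<comment> \<open>A shifted exponent could vanish only if \<open>l = - d\<close>, which is
    negative and excluded by the gap.\<close>
  have nz: "l + ereal d \<noteq> 0" if "l \<in> lyapunov_exponents M f A" for l
    using gap[OF that] assms(2) by (cases l) (auto simp: zero_ereal_def)
  obtain Eu Ec Es l0 \<alpha>0 k G E Iu Ic Is l \<alpha> \<beta> where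
    ext: "extended_oseledets_ruelle M f A l0 \<alpha>0 k G E"
    and I: "Iu \<union> Ic \<union> Is = {..<k}" "Iu \<inter> Ic = {}" "Iu \<inter> Is = {}" "Ic \<inter> Is = {}"
    and Es: "\<forall>x. Eu x = span (\<Union>i\<in>Iu. E i x) \<and> Ec x = span (\<Union>i\<in>Ic. E i x) \<and>
             Es x = span (\<Union>i\<in>Is. E i x)"
    and u: "\<forall>i\<in>Iu. \<forall>l\<in>G i. 0 < l" and s: "\<forall>i\<in>Is. \<forall>l\<in>G i. l < 0"
    and bot: "\<forall>i<k. -\<infinity> \<in> G i \<longrightarrow> i \<in> Is"
    and const: "1 \<le> l" "0 < \<alpha>" "\<alpha> < 1" "0 < \<beta>" "\<beta> < 1"
    and dom: "dominated f A UNIV l \<alpha> Eu Ec" "dominated f A UNIV l \<beta> Ec Es"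
    using assms(1) unfolding partially_hyperbolic_def partially_hyperbolic_splitting_def
    by (elim exE conjE) (rule that; assumption)
  have G: "(\<Union>i<k. G i) = lyapunov_exponents M f A"
    using ext by (auto simp: extended_oseledets_ruelle_def oseledets_grouping_def)
  have u': "0 < t" if "i \<in> Iu" "t \<in> ?s ` G i" for i t
  proof -
    obtain l where "l \<in> G i" "t = ?s l" using \<open>t \<in> ?s ` G i\<close> by blast
    moreover from this have "0 < l" using u \<open>i \<in> Iu\<close> by blast
    ultimately show ?thesis using assms(2) by (cases l) auto
  qed
  \<comment> \<open>Vacuous: no shifted label equals 0.\<close>
  have c': "i \<in> Ic" if "i < k" "0 \<in> ?s ` G i" for i
    using that nz G by force
  have s': "t < 0" if "i \<in> Is" "t \<in> ?s ` G i" for i t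
  proof -
    obtain l where "l \<in> G i" "t = ?s l" using \<open>t \<in> ?s ` G i\<close> by blast
    moreover have "i < k" using I(1) \<open>i \<in> Is\<close> by blast
    ultimately have "l \<in> lyapunov_exponents M f A" using G by blast
    moreover have "l < 0" using s \<open>i \<in> Is\<close> \<open>l \<in> G i\<close> by simp
    ultimately have "l < ereal (- d)" by (rule gap)
    with \<open>t = ?s l\<close> show ?thesis by (cases l) auto
  qed
  have bot': "i \<in> Is" if "i < k" "- \<infinity> \<in> ?s ` G i" for i
  proof -
    obtain l where "l \<in> G i" "- \<infinity> = ?s l" using \<open>- \<infinity> \<in> ?s ` G i\<close> by blast
    from \<open>- \<infinity> = ?s l\<close> have "l = - \<infinity>" by (cases l) simp_all
    then show ?thesis using bot that(1) \<open>l \<in> G i\<close> by simp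
  qed
  have splitting: "\<exists>l0 \<alpha>0 k G E Iu Ic Is.
        extended_oseledets_ruelle M f ?C l0 \<alpha>0 k G E \<and>
        Iu \<union> Ic \<union> Is = {..<k} \<and> Iu \<inter> Ic = {} \<and> Iu \<inter> Is = {} \<and> Ic \<inter> Is = {} \<and>
        (\<forall>x. Eu x = span (\<Union>i\<in>Iu. E i x) \<and>
             Ec x = span (\<Union>i\<in>Ic. E i x) \<and>
             Es x = span (\<Union>i\<in>Is. E i x)) \<and>
        (\<forall>i\<in>Iu. \<forall>l\<in>G i. 0 < l) \<and>
        (\<forall>i<k. 0 \<in> G i \<longrightarrow> i \<in> Ic) \<and>
        (\<forall>i\<in>Is. \<forall>l\<in>G i. l < 0) \<and>
        (\<forall>i<k. -\<infinity> \<in> G i \<longrightarrow> i \<in> Is)"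
    by (intro exI[of _ l0] exI[of _ \<alpha>0] exI[of _ k] exI[of _ "\<lambda>i. ?s ` G i"] exI[of _ E]
        exI[of _ Iu] exI[of _ Ic] exI[of _ Is] conjI I Es extended_oseledets_ruelle_scaleR ext
        ballI allI impI) (erule (1) u' c' s' bot')+
  have dom': "dominated f ?C UNIV l \<alpha> Eu Ec" "dominated f ?C UNIV l \<beta> Ec Es"
    using dom by (simp_all add: dominated_scaleR)
  have "partially_hyperbolic_splitting M f ?C Eu Ec Es"
    unfolding partially_hyperbolic_splitting_def
    by (rule conjI, rule splitting)
      (intro exI[of _ l] exI[of _ \<alpha>] exI[of _ \<beta>] conjI const dom')
  moreover have "0 \<notin> lyapunov_exponents M f ?C"
    unfolding lyapunov_exponents_scaleR
  proof
    assume "0 \<in> ?s ` lyapunov_exponents M f A"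
    then obtain l where "0 = ?s l" "l \<in> lyapunov_exponents M f A" by (rule imageE)
    with nz show False by metis
  qed
  ultimately show ?thesis unfolding nonuniformly_anosov_def partially_hyperbolic_def by blast
qed

theorem corollary1:
  fixes S :: "('h::{real_inner,banach} \<Rightarrow>\<^sub>L 'h) set"
    and f :: "'x::t2_space \<Rightarrow> 'x"
    and M :: "'x measure"
    and A :: "'x \<Rightarrow> 'h \<Rightarrow>\<^sub>L 'h"
    and \<epsilon> :: real
  assumes "scalar_structure S"
    and "separable_space (euclidean :: 'h topology)"
    and "\<not> finite_dimensional (UNIV :: 'h set)"
    and "compact (UNIV :: 'x set)"
    and "\<exists>g. homeomorphism UNIV UNIV f g"
    and "prob_space M" and "sets M = sets borel"
    and "invariant_measure M f" and "ergodic_measure M f"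
    and "\<And>U. open U \<Longrightarrow> U \<noteq> {} \<Longrightarrow> 0 < measure M U"
    and "integrable_cocycle S M A"
    and "partially_hyperbolic_nontrivial_unstable M f A"
    and "0 < \<epsilon>"
  shows "\<exists>C. integrable_cocycle S M C \<and> nonuniformly_anosov M f C \<and>
             (SUP x. norm (A x - C x)) \<le> \<epsilon>"
proof -
  have "bounded (range A)"
    using assms(4,11) compact_continuous_image compact_imp_bounded
    unfolding integrable_cocycle_def by blast
  \<comment> \<open>The bound is chosen positive, even for a vanishing cocycle, because \<epsilon>
    is divided by it below.\<close>
  then obtain B where B: "0 < B" "\<And>x. norm (A x) \<le> B" by (auto simp: bounded_pos)
  obtain \<delta> where "0 < \<delta>"
    and gap: "\<And>l. l \<in> lyapunov_exponents M f A \<Longrightarrow> l < 0 \<Longrightarrow> l < ereal (- \<delta>)"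
    using negative_lyapunov_exponents_gap[OF assms(6)] by blast
  \<comment> \<open>The first bound keeps \<open>d\<close> within the spectral gap. The second gives
    \<open>exp d - 1\<close> at most \<open>\<epsilon> / B\<close>, which controls the distance
    between the scaled cocycle and \<open>A\<close>.\<close>
  define d where "d = min \<delta> (ln (1 + \<epsilon> / B))"
  have "1 < 1 + \<epsilon> / B" using B(1) assms(13) by simp
  then have "0 < ln (1 + \<epsilon> / B)" by (rule ln_gt_zero)
  then have "0 < d" using \<open>0 < \<delta>\<close> by (simp add: d_def)
  have "exp d \<le> exp (ln (1 + \<epsilon> / B))" by (simp add: d_def)
  also have "\<dots> = 1 + \<epsilon> / B" using B(1) assms(13) by (simp add: add_pos_pos)
  finally have small: "(exp d - 1) * B \<le> \<epsilon>" using B(1) by (simp add: field_simps)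
  have "l < ereal (- d)" if "l \<in> lyapunov_exponents M f A" "l < 0" for l
    by (rule order.strict_trans2[OF gap[OF that]]) (simp add: d_def)
  moreover have "partially_hyperbolic M f A"
    using assms(12)
    unfolding partially_hyperbolic_nontrivial_unstable_def partially_hyperbolic_def by blast
  ultimately have "nonuniformly_anosov M f (\<lambda>x. exp d *\<^sub>R A x)"
    using \<open>0 < d\<close> by (intro nonuniformly_anosov_scaleR)
  moreover have "integrable_cocycle S M (\<lambda>x. exp d *\<^sub>R A x)"
    by (rule integrable_cocycle_scaleR[OF assms(6,7,4,11)])
  moreover have "norm (A x - exp d *\<^sub>R A x) \<le> \<epsilon>" for x
  proof -
    have "A x - exp d *\<^sub>R A x = (1 - exp d) *\<^sub>R A x" by (simp add: algebra_simps)
    then have "norm (A x - exp d *\<^sub>R A x) = (exp d - 1) * norm (A x)" using \<open>0 < d\<close> by simp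
    also have "\<dots> \<le> (exp d - 1) * B" using B(2) \<open>0 < d\<close> by (intro mult_left_mono) auto
    finally show ?thesis using small by linarith
  qed
  then have "(SUP x. norm (A x - exp d *\<^sub>R A x)) \<le> \<epsilon>" by (intro cSUP_least) auto
  ultimately show ?thesis by (intro exI[of _ "\<lambda>x. exp d *\<^sub>R A x"] conjI)
qed

end
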